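(* Deductions in $\mathbf{CNF}$ can be brought into normal form: for every deduction in $\mathbf{CNF}$ of a formula $A$ from a set $\Gamma$ of open assumptions there is a deduction in $\mathbf{CNF}$ of $A$, all of whose open assumptions belong to $\Gamma$, which is in normal form.
   Context: **Language.** First-order language with parameters $a,b,\ldots$ (used as free variables, distinct in shape from the bound variables $x,y,z,\ldots$), constants, predicate letters, identity $=$, a one-place existence predicate $\exists!$, and $\bot,\rightarrow,\forall$; $\neg A$ is $A\rightarrow\bot$. Terms are parameters and constants. $A_t^x$ is $A$ with $t$ replacing all free occurrences of $x$. Prime (here also: atomic) formulas are those formed by a predicate letter, $\exists!$ or $=$ from terms; $\bot$ is not prime. **Rules of $\mathbf{CNF}$** (classical negative free logic; natural deduction trees, $[A]$ marks a class of assumptions discharged by the rule, vacuous discharge allowed). $(\rightarrow I)$: from a deduction of $B$ from $[A]$ infer $A\rightarrow B$. $(\rightarrow E)$: from $A\rightarrow B$ and $A$ infer $B$. $(\bot E_C)$: from a deduction of $\bot$ from $[\neg A]$ infer $A$. $(\forall I)$: from a deduction $\Pi$ of $A_a^x$ from $[\exists!a]$ infer $\forall xA$, where $a$ does not occur in $\forall xA$ nor in undischarged assumptions of $\Pi$ except those in the class of $\exists!a$. $(\forall E)$: from $\forall xA$ and $\exists!t$ infer $A_t^x$. $(=I^n)$: from $\exists!t$ infer $t=t$. $(=E)$: from $t_1=t_2$ and $A_{t_1}^x$ infer $A_{t_2}^x$. $(AD)$: from $Rt_1\ldots t_n$ infer $\exists!t_i$ ($1\le i\le n$), where $R$ is a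 predicate letter (not $\exists!$) or $=$. **Standing conventions.** Applications of $(=E)$ have atomic conclusions and applications of $(\bot E_C)$ have prime conclusions. Vacuous applications of $(=E)$ (major premise $t=t$) are assumed to be always removed. The major premise of an elimination rule is its leftmost premise in the list above, the other premises are minor. **Normal form.** The following are maximal. (1) A formula occurrence that is the conclusion of an introduction rule and the major premise of an elimination rule. (2) A *maximal $=$-formula*: a formula $t=t$ that is concluded by $(=I^n)$ and is the premise of $(AD)$. (3) A *maximal $\exists!$-formula*: a formula $\exists!t$ that is concluded from $t=t$ by $(AD)$ and is the premise of $(=I^n)$. (4) A *maximal $(=E)$-segment*: an $(=E)$-segment is a sequence of formula occurrences $A_1,\ldots,A_n$ where $A_1$ is the minor premise but not the conclusion of $(=E)$, $A_n$ is the conclusion but not the minor premise of $(=E)$, each $A_i$ with $1<i<n$ is both, and $A_{i+1}$ is concluded from minor premise $A_i$; it is maximal if its last formula is the premise of $(AD)$ or if all formulas on it are of the form $\exists!t$. A deduction is in *normal form* if it contains none of these. *)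

theory Defs
  imports Main
begin

section \<open>Language\<close>

text \<open>
  Parameters and bound variables are two disjoint countably infinite supplies of symbols.
  Only parameters and constants are terms of the language; \<open>Var x\<close> occurs in formulas only
  in the scope of a quantifier \<open>\<forall>x\<close>.
\<close>

type_synonym param = nat
type_synonym var = nat

datatype 'c tm = Par param | Con 'c | Var var

datatype ('c, 'r) fm =
    Pred 'r "'c tm list"
  | Exi "'c tm"
  | Eq "'c tm" "'c tm"
  | Bot
  | Imp "('c, 'r) fm" "('c, 'r) fm"
  | Forall var "('c, 'r) fm"

abbreviation Neg :: "('c, 'r) fm \<Rightarrow> ('c, 'r) fm" where
  "Neg A \<equiv> Imp A Bot"

text \<open>
  The constants and predicate letters of a language are subsets of the types \<open>'c\<close> and \<open>'r\<close>,
  so that a language may lack constants or predicate letters altogether.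
\<close>

record ('c, 'r) language =
  consts_of :: "'c set"
  preds_of :: "'r set"
  arity :: "'r \<Rightarrow> nat"

fun fv_tm :: "'c tm \<Rightarrow> var set" where
  "fv_tm (Var x) = {x}"
| "fv_tm _ = {}"

fun fv :: "('c, 'r) fm \<Rightarrow> var set" where
  "fv (Pred R ts) = (\<Union>t\<in>set ts. fv_tm t)"
| "fv (Exi t) = fv_tm t"
| "fv (Eq s t) = fv_tm s \<union> fv_tm t"
| "fv Bot = {}"
| "fv (Imp A B) = fv A \<union> fv B"
| "fv (Forall x A) = fv A - {x}"

fun params_tm :: "'c tm \<Rightarrow> param set" where
  "params_tm (Par a) = {a}"
| "params_tm _ = {}"

fun params :: "('c, 'r) fm \<Rightarrow> param set" where
  "params (Pred R ts) = (\<Union>t\<in>set ts. params_tm t)"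
| "params (Exi t) = params_tm t"
| "params (Eq s t) = params_tm s \<union> params_tm t"
| "params Bot = {}"
| "params (Imp A B) = params A \<union> params B"
| "params (Forall x A) = params A"

fun tm_over :: "('c, 'r) language \<Rightarrow> 'c tm \<Rightarrow> bool" where
  "tm_over L (Con c) \<longleftrightarrow> c \<in> consts_of L"
| "tm_over L _ \<longleftrightarrow> True"

fun fm_over :: "('c, 'r) language \<Rightarrow> ('c, 'r) fm \<Rightarrow> bool" where
  "fm_over L (Pred R ts) \<longleftrightarrow>
     R \<in> preds_of L \<and> length ts = arity L R \<and> (\<forall>t\<in>set ts. tm_over L t)"
| "fm_over L (Exi t) \<longleftrightarrow> tm_over L t"
| "fm_over L (Eq s t) \<longleftrightarrow> tm_over L s \<and> tm_over L t"
| "fm_over L Bot \<longleftrightarrow> True"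
| "fm_over L (Imp A B) \<longleftrightarrow> fm_over L A \<and> fm_over L B"
| "fm_over L (Forall x A) \<longleftrightarrow> fm_over L A"

definition formula :: "('c, 'r) language \<Rightarrow> ('c, 'r) fm \<Rightarrow> bool" where
  "formula L A \<longleftrightarrow> fm_over L A \<and> fv A = {}"

text \<open>
  \<open>subst x t A\<close> is \<open>A\<close> with \<open>t\<close> for all free occurrences of \<open>x\<close>. In deductions \<open>t\<close> is always
  a parameter or a constant, hence no variable can be captured.
\<close>

fun subst_tm :: "var \<Rightarrow> 'c tm \<Rightarrow> 'c tm \<Rightarrow> 'c tm" where
  "subst_tm x t (Var y) = (if y = x then t else Var y)"
| "subst_tm x t s = s"

fun subst :: "var \<Rightarrow> 'c tm \<Rightarrow> ('c, 'r) fm \<Rightarrow> ('c, 'r) fm" where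
  "subst x t (Pred R ts) = Pred R (map (subst_tm x t) ts)"
| "subst x t (Exi s) = Exi (subst_tm x t s)"
| "subst x t (Eq r s) = Eq (subst_tm x t r) (subst_tm x t s)"
| "subst x t Bot = Bot"
| "subst x t (Imp A B) = Imp (subst x t A) (subst x t B)"
| "subst x t (Forall y A) = Forall y (if y = x then A else subst x t A)"

fun prime_fm :: "('c, 'r) fm \<Rightarrow> bool" where
  "prime_fm (Pred R ts) \<longleftrightarrow> True"
| "prime_fm (Exi t) \<longleftrightarrow> True"
| "prime_fm (Eq s t) \<longleftrightarrow> True"
| "prime_fm _ \<longleftrightarrow> False"


section \<open>Deductions\<close>

text \<open>
  An assumption class is given by a label together with a formula. \<open>ImpI u A\<close>, \<open>BotEC u A\<close> and
  \<open>AllI u a x A\<close> discharge the (possibly empty) class labelled \<open>u\<close> of \<open>A\<close>, of \<open>Neg A\<close> and of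
  \<open>Exi (Par a)\<close>, respectively. Subdeductions are listed with that of the major premise first;
  the formula argument of \<open>ImpE\<close>, \<open>BotEC\<close>, \<open>AllE\<close> and \<open>EqE\<close> is the conclusion.
\<close>

type_synonym label = nat

datatype ('c, 'r) ded =
    Assm label "('c, 'r) fm"
  | ImpI label "('c, 'r) fm" "('c, 'r) ded"
  | ImpE "('c, 'r) fm" "('c, 'r) ded" "('c, 'r) ded"
  | BotEC label "('c, 'r) fm" "('c, 'r) ded"
  | AllI label param var "('c, 'r) fm" "('c, 'r) ded"
  | AllE "('c, 'r) fm" "('c, 'r) ded" "('c, 'r) ded"
  | EqI "'c tm" "('c, 'r) ded"
  | EqE "('c, 'r) fm" "('c, 'r) ded" "('c, 'r) ded"
  | AD "'c tm" "('c, 'r) ded"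

fun concl :: "('c, 'r) ded \<Rightarrow> ('c, 'r) fm" where
  "concl (Assm u A) = A"
| "concl (ImpI u A d) = Imp A (concl d)"
| "concl (ImpE B d e) = B"
| "concl (BotEC u A d) = A"
| "concl (AllI u a x A d) = Forall x A"
| "concl (AllE B d e) = B"
| "concl (EqI t d) = Eq t t"
| "concl (EqE B d e) = B"
| "concl (AD t d) = Exi t"

fun premise_deds :: "('c, 'r) ded \<Rightarrow> ('c, 'r) ded list" where
  "premise_deds (Assm u A) = []"
| "premise_deds (ImpI u A d) = [d]"
| "premise_deds (ImpE B d e) = [d, e]"
| "premise_deds (BotEC u A d) = [d]"
| "premise_deds (AllI u a x A d) = [d]"
| "premise_deds (AllE B d e) = [d, e]"
| "premise_deds (EqI t d) = [d]"
| "premise_deds (EqE B d e) = [d, e]"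
| "premise_deds (AD t d) = [d]"

fun open_classes :: "('c, 'r) ded \<Rightarrow> (label \<times> ('c, 'r) fm) set" where
  "open_classes (Assm u A) = {(u, A)}"
| "open_classes (ImpI u A d) = open_classes d - {(u, A)}"
| "open_classes (ImpE B d e) = open_classes d \<union> open_classes e"
| "open_classes (BotEC u A d) = open_classes d - {(u, Neg A)}"
| "open_classes (AllI u a x A d) = open_classes d - {(u, Exi (Par a))}"
| "open_classes (AllE B d e) = open_classes d \<union> open_classes e"
| "open_classes (EqI t d) = open_classes d"
| "open_classes (EqE B d e) = open_classes d \<union> open_classes e"
| "open_classes (AD t d) = open_classes d"

definition open_assms :: "('c, 'r) ded \<Rightarrow> ('c, 'r) fm set" where
  "open_assms d = snd ` open_classes d"

text \<open>
  The conventions on deductions are part of the rules: conclusions of \<open>BotEC\<close> and \<open>EqE\<close> are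
  prime, and the two terms in the major premise of \<open>EqE\<close> are distinct, i.e. no application of
  \<open>EqE\<close> is vacuous.
\<close>

inductive deduction :: "('c, 'r) language \<Rightarrow> ('c, 'r) ded \<Rightarrow> bool" for L where
  Assm: "formula L A \<Longrightarrow> deduction L (Assm u A)"
| ImpI: "deduction L d \<Longrightarrow> formula L A \<Longrightarrow> deduction L (ImpI u A d)"
| ImpE: "deduction L d \<Longrightarrow> deduction L e \<Longrightarrow> concl d = Imp A B \<Longrightarrow> concl e = A
    \<Longrightarrow> deduction L (ImpE B d e)"
| BotEC: "deduction L d \<Longrightarrow> concl d = Bot \<Longrightarrow> formula L A \<Longrightarrow> prime_fm A
    \<Longrightarrow> deduction L (BotEC u A d)"
| AllI: "deduction L d \<Longrightarrow> concl d = subst x (Par a) A \<Longrightarrow> formula L (Forall x A)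
    \<Longrightarrow> a \<notin> params (Forall x A)
    \<Longrightarrow> \<forall>(v, B) \<in> open_classes d - {(u, Exi (Par a))}. a \<notin> params B
    \<Longrightarrow> deduction L (AllI u a x A d)"
| AllE: "deduction L d \<Longrightarrow> deduction L e \<Longrightarrow> concl d = Forall x A \<Longrightarrow> concl e = Exi t
    \<Longrightarrow> deduction L (AllE (subst x t A) d e)"
| EqI: "deduction L d \<Longrightarrow> concl d = Exi t \<Longrightarrow> deduction L (EqI t d)"
| EqE: "deduction L d \<Longrightarrow> deduction L e \<Longrightarrow> concl d = Eq t1 t2 \<Longrightarrow> concl e = subst x t1 A
    \<Longrightarrow> prime_fm A \<Longrightarrow> t1 \<noteq> t2 \<Longrightarrow> deduction L (EqE (subst x t2 A) d e)"
| AD_Pred: "deduction L d \<Longrightarrow> concl d = Pred R ts \<Longrightarrow> t \<in> set ts \<Longrightarrow> deduction L (AD t d)"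
| AD_Eq: "deduction L d \<Longrightarrow> concl d = Eq t1 t2 \<Longrightarrow> t \<in> {t1, t2} \<Longrightarrow> deduction L (AD t d)"


section \<open>Normal form\<close>

text \<open>
  Formula occurrences are represented by positions: \<open>p @ [i]\<close> is the \<open>i\<close>-th premise, counted
  from \<open>0\<close>, of the inference whose conclusion is at \<open>p\<close>. \<open>occ d p e\<close> says that \<open>e\<close> is the
  subdeduction of \<open>d\<close> ending at \<open>p\<close>; the formula at \<open>p\<close> is then \<open>concl e\<close>.
\<close>

type_synonym pos = "nat list"

inductive occ :: "('c, 'r) ded \<Rightarrow> pos \<Rightarrow> ('c, 'r) ded \<Rightarrow> bool" for d where
  root: "occ d [] d"
| premise: "occ d p e \<Longrightarrow> i < length (premise_deds e) \<Longrightarrow> occ d (p @ [i]) (premise_deds e ! i)"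

fun is_intro :: "('c, 'r) ded \<Rightarrow> bool" where
  "is_intro (ImpI u A d) \<longleftrightarrow> True"
| "is_intro (AllI u a x A d) \<longleftrightarrow> True"
| "is_intro (EqI t d) \<longleftrightarrow> True"
| "is_intro _ \<longleftrightarrow> False"

text \<open>
  Counting \<open>AD\<close> as an elimination rule would add to the maximal formulas just the
  maximal \<open>=\<close>-formulas.
\<close>

fun is_elim :: "('c, 'r) ded \<Rightarrow> bool" where
  "is_elim (ImpE B d e) \<longleftrightarrow> True"
| "is_elim (BotEC u A d) \<longleftrightarrow> True"
| "is_elim (AllE B d e) \<longleftrightarrow> True"
| "is_elim (EqE B d e) \<longleftrightarrow> True"
| "is_elim _ \<longleftrightarrow> False"

definition maximal_formula :: "('c, 'r) ded \<Rightarrow> pos \<Rightarrow> bool" where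
  "maximal_formula d p \<longleftrightarrow>
     (\<exists>e q f. occ d p e \<and> is_intro e \<and> p = q @ [0] \<and> occ d q f \<and> is_elim f)"

definition AD_premise :: "('c, 'r) ded \<Rightarrow> pos \<Rightarrow> bool" where
  "AD_premise d p \<longleftrightarrow> (\<exists>q t e. p = q @ [0] \<and> occ d q (AD t e))"

definition EqI_premise :: "('c, 'r) ded \<Rightarrow> pos \<Rightarrow> bool" where
  "EqI_premise d p \<longleftrightarrow> (\<exists>q t e. p = q @ [0] \<and> occ d q (EqI t e))"

definition EqE_minor :: "('c, 'r) ded \<Rightarrow> pos \<Rightarrow> bool" where
  "EqE_minor d p \<longleftrightarrow> (\<exists>q B e f. p = q @ [1] \<and> occ d q (EqE B e f))"

definition EqE_concl :: "('c, 'r) ded \<Rightarrow> pos \<Rightarrow> bool" where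
  "EqE_concl d p \<longleftrightarrow> (\<exists>B e f. occ d p (EqE B e f))"

definition maximal_eq_formula :: "('c, 'r) ded \<Rightarrow> pos \<Rightarrow> bool" where
  "maximal_eq_formula d p \<longleftrightarrow> (\<exists>t e. occ d p (EqI t e)) \<and> AD_premise d p"

definition maximal_exi_formula :: "('c, 'r) ded \<Rightarrow> pos \<Rightarrow> bool" where
  "maximal_exi_formula d p \<longleftrightarrow>
     (\<exists>t e. occ d p (AD t e) \<and> concl e = Eq t t) \<and> EqI_premise d p"

definition EqE_segment :: "('c, 'r) ded \<Rightarrow> pos list \<Rightarrow> bool" where
  "EqE_segment d ps \<longleftrightarrow>
     ps \<noteq> [] \<and>
     EqE_minor d (hd ps) \<and> \<not> EqE_concl d (hd ps) \<and>
     EqE_concl d (last ps) \<and> \<not> EqE_minor d (last ps) \<and>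
     (\<forall>i. 0 < i \<and> Suc i < length ps \<longrightarrow> EqE_concl d (ps ! i) \<and> EqE_minor d (ps ! i)) \<and>
     (\<forall>i. Suc i < length ps \<longrightarrow> ps ! i = ps ! Suc i @ [1])"

definition maximal_EqE_segment :: "('c, 'r) ded \<Rightarrow> pos list \<Rightarrow> bool" where
  "maximal_EqE_segment d ps \<longleftrightarrow> EqE_segment d ps \<and>
     (AD_premise d (last ps) \<or> (\<forall>p\<in>set ps. \<exists>e t. occ d p e \<and> concl e = Exi t))"

definition normal_form :: "('c, 'r) ded \<Rightarrow> bool" where
  "normal_form d \<longleftrightarrow>
     (\<forall>p. \<not> maximal_formula d p) \<and>
     (\<forall>p. \<not> maximal_eq_formula d p) \<and>
     (\<forall>p. \<not> maximal_exi_formula d p) \<and>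
     (\<forall>ps. \<not> maximal_EqE_segment d ps)"

end

theory Submission
  imports Defs
begin

text \<open>
  Normalisation by evaluation. Finite sets of formulas are the worlds of a Kripke model in which
  prime formulas and \<open>Bot\<close> are forced where they have a normal deduction. Every deduction is sound
  for forcing, under every substitution of closed terms for parameters, and a forced formula has a
  normal deduction. The rules for identity and existence and \<open>BotEC\<close> act on prime formulas and
  \<open>Bot\<close>, so for them soundness amounts to being admissible for normal deductions. The conversions
  removing maximal \<open>=\<close>- and \<open>\<exists>!\<close>-formulas and \<open>EqE\<close>-segments are needed only there.
\<close>

section \<open>Local characterisation of normal form\<close>

text \<open>Each inference is checked against its immediate premises only, so positions and segments
  disappear and recursion applies. Both kinds of maximal \<open>EqE\<close>-segment show at their
  last inference: it concludes \<open>Exi t\<close>, or \<open>AD\<close> stands directly below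
  it.\<close>

fun normal :: "('c, 'r) ded \<Rightarrow> bool" where
  "normal (Assm u A) \<longleftrightarrow> True"
| "normal (ImpI u A d) \<longleftrightarrow> normal d"
| "normal (ImpE B d e) \<longleftrightarrow> normal d \<and> normal e \<and> \<not> is_intro d"
| "normal (BotEC u A d) \<longleftrightarrow> normal d \<and> \<not> is_intro d"
| "normal (AllI u a x A d) \<longleftrightarrow> normal d"
| "normal (AllE B d e) \<longleftrightarrow> normal d \<and> normal e \<and> \<not> is_intro d"
| "normal (EqI t d) \<longleftrightarrow> normal d \<and> (\<forall>s e. d = AD s e \<longrightarrow> concl e \<noteq> Eq s s)"
| "normal (EqE B d e) \<longleftrightarrow> normal d \<and> normal e \<and> \<not> is_intro d \<and> (\<forall>t. B \<noteq> Exi t)"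
| "normal (AD t d) \<longleftrightarrow> normal d \<and> (\<forall>s e. d \<noteq> EqI s e) \<and> (\<forall>B e f. d \<noteq> EqE B e f)"

lemma occ_Nil_iff: "occ d [] e \<longleftrightarrow> e = d"
  by (auto elim: occ.cases intro: occ.root)

lemma occ_snoc_iff:
  "occ d (p @ [i]) e \<longleftrightarrow>
    (\<exists>f. occ d p f \<and> i < length (premise_deds f) \<and> e = premise_deds f ! i)"
  by (auto elim: occ.cases intro: occ.premise)

lemma occ_unique: "occ d p e \<Longrightarrow> occ d p f \<Longrightarrow> e = f"
proof (induction p arbitrary: e f rule: rev_induct)
  case Nil
  then show ?case by (simp add: occ_Nil_iff)
next
  case (snoc i p)
  then show ?case by (metis occ_snoc_iff)
qed

lemma normal_occ: "occ d p e \<Longrightarrow> normal d \<Longrightarrow> normal e"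
proof (induction rule: occ.induct)
  case (premise p e i)
  then show ?case by (cases e) (auto simp: less_Suc_eq nth_Cons')
qed

text \<open>A maximal formula involves two adjacent inferences; \<open>occ_unique\<close> identifies
  the upper one with the premise deduction of the lower one, and \<open>normal\<close> of the latter
  excludes the pair. For a segment it suffices to look at its last formula, the conclusion of an
  \<open>EqE\<close>.\<close>

lemma normal_imp_normal_form:
  assumes "normal d"
  shows "normal_form d"
proof -
  have no_max: "\<not> maximal_formula d p" for p
  proof
    assume "maximal_formula d p"
    then obtain e q f where occs: "occ d (q @ [0]) e" "is_intro e" "occ d q f" "is_elim f"
      unfolding maximal_formula_def by blast
    then have "e = premise_deds f ! 0"
      by (metis occ_snoc_iff occ_unique)
    moreover have "normal f" using occs assms normal_occ by blast
    ultimately show False using occs by (cases f) auto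
  qed
  have no_eq: "\<not> maximal_eq_formula d p" for p
  proof
    assume "maximal_eq_formula d p"
    then obtain q t e s f where occs: "occ d (q @ [0]) (EqI t e)" "occ d q (AD s f)"
      unfolding maximal_eq_formula_def AD_premise_def by blast
    then have "EqI t e = f"
      by (metis occ_snoc_iff occ_unique premise_deds.simps(9) nth_Cons_0)
    with occs assms normal_occ show False by fastforce
  qed
  have no_exi: "\<not> maximal_exi_formula d p" for p
  proof
    assume "maximal_exi_formula d p"
    then obtain q t e s f where occs: "occ d (q @ [0]) (AD t e)" "concl e = Eq t t"
        "occ d q (EqI s f)"
      unfolding maximal_exi_formula_def EqI_premise_def by blast
    then have "AD t e = f"
      by (metis occ_snoc_iff occ_unique premise_deds.simps(7) nth_Cons_0)
    with occs assms normal_occ show False by fastforce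
  qed
  have no_seg: "\<not> maximal_EqE_segment d ps" for ps
  proof
    assume max: "maximal_EqE_segment d ps"
    then obtain B e f where last: "occ d (last ps) (EqE B e f)" and ne: "ps \<noteq> []"
      unfolding maximal_EqE_segment_def EqE_segment_def EqE_concl_def by blast
    have B: "B \<noteq> Exi t" for t using normal_occ[OF last assms] by simp
    from max consider "AD_premise d (last ps)" | g t where "occ d (last ps) g" "concl g = Exi t"
      unfolding maximal_EqE_segment_def using ne last_in_set by blast
    then show False
    proof cases
      case 1
      then obtain q t g where q: "last ps = q @ [0]" "occ d q (AD t g)"
        unfolding AD_premise_def by blast
      then have "EqE B e f = g"
        using last by (metis occ_snoc_iff occ_unique premise_deds.simps(9) nth_Cons_0)
      with q assms normal_occ show False by fastforce
    next
      case 2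
      then show False using occ_unique[OF last] B by fastforce
    qed
  qed
  show ?thesis
    unfolding normal_form_def using no_max no_eq no_exi no_seg by blast
qed

section \<open>Formulas and substitution\<close>

lemma fv_tm_subst_tm: "fv_tm t = {} \<Longrightarrow> fv_tm (subst_tm x t s) = fv_tm s - {x}"
  by (cases s) auto

lemma fv_subst: "fv_tm t = {} \<Longrightarrow> fv (subst x t A) = fv A - {x}"
  by (induction A) (auto simp: fv_tm_subst_tm)

lemma tm_over_subst_tm: "tm_over L t \<Longrightarrow> tm_over L s \<Longrightarrow> tm_over L (subst_tm x t s)"
  by (cases s) auto

lemma tm_over_subst_tm_iff:
  "tm_over L s \<Longrightarrow> tm_over L t \<Longrightarrow> tm_over L (subst_tm x s r) = tm_over L (subst_tm x t r)"
  by (cases r) auto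

lemma fm_over_subst: "tm_over L t \<Longrightarrow> fm_over L A \<Longrightarrow> fm_over L (subst x t A)"
  by (induction A) (auto simp: tm_over_subst_tm)

text \<open>In \<open>EqE\<close> the formula \<open>A\<close> is given only through its instance
  with \<open>t1\<close>, so well-formedness has to pass from one instance to the other.\<close>

lemma fm_over_subst_iff:
  "tm_over L s \<Longrightarrow> tm_over L t \<Longrightarrow> fm_over L (subst x s A) = fm_over L (subst x t A)"
  by (induction A) (auto simp: tm_over_subst_tm_iff[of L s t])

lemma formula_subst:
  "formula L (Forall x A) \<Longrightarrow> formula L (Exi t) \<Longrightarrow> formula L (subst x t A)"
  by (auto simp: formula_def fv_subst fm_over_subst)

lemma formula_concl: "deduction L d \<Longrightarrow> formula L (concl d)"
proof (induction rule: deduction.induct)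
  case (AllE d e x A t)
  then show ?case by (simp add: formula_subst)
next
  case (EqE d e t1 t2 x A)
  then show ?case by (auto simp: formula_def fv_subst fm_over_subst_iff[of L t1 t2])
qed (auto simp: formula_def)

lemma formula_open_classes: "deduction L d \<Longrightarrow> (u, B) \<in> open_classes d \<Longrightarrow> formula L B"
  by (induction rule: deduction.induct) auto

lemma finite_open_classes: "finite (open_classes d)"
  by (induction d) auto

lemma finite_params: "finite (params A)"
proof (induction A)
  case (Pred R ts)
  have "finite (params_tm t)" for t :: "'a tm" by (cases t) auto
  then show ?case by simp
next
  case (Exi t)
  then show ?case by (cases t) auto
next
  case (Eq s t)
  then show ?case by (cases s; cases t) auto
qed auto

section \<open>Simultaneous substitution of terms for parameters\<close>

fun psubst_tm :: "(param \<Rightarrow> 'c tm) \<Rightarrow> 'c tm \<Rightarrow> 'c tm" where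
  "psubst_tm \<sigma> (Par a) = \<sigma> a"
| "psubst_tm \<sigma> t = t"

text \<open>Plays the role of the environment in the evaluation of deductions: the eigenparameter of
  \<open>AllI\<close> must be sent to arbitrary existing terms while the other parameters keep their
  values.\<close>

fun psubst :: "(param \<Rightarrow> 'c tm) \<Rightarrow> ('c, 'r) fm \<Rightarrow> ('c, 'r) fm" where
  "psubst \<sigma> (Pred R ts) = Pred R (map (psubst_tm \<sigma>) ts)"
| "psubst \<sigma> (Exi t) = Exi (psubst_tm \<sigma> t)"
| "psubst \<sigma> (Eq s t) = Eq (psubst_tm \<sigma> s) (psubst_tm \<sigma> t)"
| "psubst \<sigma> Bot = Bot"
| "psubst \<sigma> (Imp A B) = Imp (psubst \<sigma> A) (psubst \<sigma> B)"
| "psubst \<sigma> (Forall x A) = Forall x (psubst \<sigma> A)"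

lemma psubst_tm_Par: "psubst_tm Par t = t"
  by (cases t) auto

lemma psubst_Par: "psubst Par A = A"
  by (induction A) (auto simp: psubst_tm_Par map_idI)

lemma psubst_tm_cong: "(\<And>a. a \<in> params_tm t \<Longrightarrow> \<sigma> a = \<tau> a) \<Longrightarrow> psubst_tm \<sigma> t = psubst_tm \<tau> t"
  by (cases t) auto

lemma psubst_cong: "(\<And>a. a \<in> params A \<Longrightarrow> \<sigma> a = \<tau> a) \<Longrightarrow> psubst \<sigma> A = psubst \<tau> A"
  by (induction A) (auto intro!: psubst_tm_cong)

lemma prime_fm_psubst [simp]: "prime_fm (psubst \<sigma> A) = prime_fm A"
  by (cases A) auto

lemma subst_tm_closed: "fv_tm s = {} \<Longrightarrow> subst_tm x t s = s"
  by (cases s) auto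

lemma psubst_tm_subst_tm:
  "(\<And>a. fv_tm (\<sigma> a) = {}) \<Longrightarrow>
    psubst_tm \<sigma> (subst_tm x t s) = subst_tm x (psubst_tm \<sigma> t) (psubst_tm \<sigma> s)"
  by (cases s) (auto simp: subst_tm_closed)

text \<open>The values of \<open>\<sigma>\<close> must be closed; otherwise the outer substitution
  for \<open>x\<close> would also act inside them.\<close>

lemma psubst_subst:
  "(\<And>a. fv_tm (\<sigma> a) = {}) \<Longrightarrow>
    psubst \<sigma> (subst x t A) = subst x (psubst_tm \<sigma> t) (psubst \<sigma> A)"
  by (induction A) (auto simp: psubst_tm_subst_tm)

lemma formula_psubst:
  assumes "\<And>a. formula L (Exi (\<sigma> a) :: ('c, 'r) fm)" and "formula L (A :: ('c, 'r) fm)"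
  shows "formula L (psubst \<sigma> A)"
proof -
  have tm: "fv_tm (psubst_tm \<sigma> t) = fv_tm t \<and> (tm_over L t \<longrightarrow> tm_over L (psubst_tm \<sigma> t))" for t
    using assms(1) by (cases t) (auto simp: formula_def)
  have "fv (psubst \<sigma> A) = fv A" for A :: "('c, 'r) fm"
    by (induction A) (auto simp: tm)
  moreover have "fm_over L A \<Longrightarrow> fm_over L (psubst \<sigma> A)" for A :: "('c, 'r) fm"
    by (induction A) (auto simp: tm)
  ultimately show ?thesis using assms(2) by (simp add: formula_def)
qed

section \<open>Admissible rules for normal deductions\<close>

text \<open>
  All labels are \<open>0\<close>, so discharging the class of a formula removes the formula from the context.
\<close>

definition derives :: "('c, 'r) language \<Rightarrow> ('c, 'r) fm set \<Rightarrow> ('c, 'r) fm \<Rightarrow> ('c, 'r) ded \<Rightarrow> bool" where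
  "derives L \<Gamma> A d \<longleftrightarrow>
     deduction L d \<and> concl d = A \<and> normal d \<and> open_classes d \<subseteq> {0} \<times> \<Gamma>"

definition nf :: "('c, 'r) language \<Rightarrow> ('c, 'r) fm set \<Rightarrow> ('c, 'r) fm \<Rightarrow> bool" where
  "nf L \<Gamma> A \<longleftrightarrow> (\<exists>d. derives L \<Gamma> A d)"

text \<open>Neutral derivability: a deduction not ending with an introduction can be the major
  premise of an elimination without creating a maximal formula.\<close>

definition ne :: "('c, 'r) language \<Rightarrow> ('c, 'r) fm set \<Rightarrow> ('c, 'r) fm \<Rightarrow> bool" where
  "ne L \<Gamma> A \<longleftrightarrow> (\<exists>d. derives L \<Gamma> A d \<and> \<not> is_intro d)"

lemma ne_imp_nf: "ne L \<Gamma> A \<Longrightarrow> nf L \<Gamma> A"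
  by (auto simp: ne_def nf_def)

text \<open>Weakening keeps the deduction unchanged: the context only bounds its open assumptions,
  and eigenparameter conditions concern the assumptions that actually occur.\<close>

lemma nf_mono: "nf L \<Gamma> A \<Longrightarrow> \<Gamma> \<subseteq> \<Delta> \<Longrightarrow> nf L \<Delta> A"
  unfolding nf_def derives_def by blast

lemma ne_mono: "ne L \<Gamma> A \<Longrightarrow> \<Gamma> \<subseteq> \<Delta> \<Longrightarrow> ne L \<Delta> A"
  unfolding ne_def derives_def by blast

lemma nf_formula: "nf L \<Gamma> A \<Longrightarrow> formula L A"
  by (auto simp: nf_def derives_def formula_concl)

lemma ne_Assm: "formula L A \<Longrightarrow> A \<in> \<Gamma> \<Longrightarrow> ne L \<Gamma> A"
  unfolding ne_def derives_def by (rule exI[of _ "Assm 0 A"]) (simp add: deduction.Assm)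

lemma nf_ImpI:
  assumes "nf L (insert A \<Gamma>) B" "formula L A"
  shows "nf L \<Gamma> (Imp A B)"
proof -
  obtain d where "derives L (insert A \<Gamma>) B d" using assms(1) by (auto simp: nf_def)
  then have "derives L \<Gamma> (Imp A B) (ImpI 0 A d)"
    using assms(2) by (auto simp: derives_def intro: deduction.ImpI)
  then show ?thesis by (auto simp: nf_def)
qed

lemma ne_ImpE:
  assumes "ne L \<Gamma> (Imp A B)" "nf L \<Gamma> A"
  shows "ne L \<Gamma> B"
proof -
  obtain d e where "derives L \<Gamma> (Imp A B) d" "\<not> is_intro d" "derives L \<Gamma> A e"
    using assms by (auto simp: nf_def ne_def)
  then have "derives L \<Gamma> B (ImpE B d e)"
    by (auto simp: derives_def intro: deduction.ImpE)
  then show ?thesis unfolding ne_def by (intro exI[of _ "ImpE B d e"]) simp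
qed

text \<open>No introduction rule concludes \<open>Bot\<close>, so the premise is automatically
  neutral.\<close>

lemma ne_BotEC:
  assumes "nf L (insert (Neg A) \<Gamma>) Bot" "formula L A" "prime_fm A"
  shows "ne L \<Gamma> A"
proof -
  obtain d where d: "derives L (insert (Neg A) \<Gamma>) Bot d" using assms(1) by (auto simp: nf_def)
  then have "\<not> is_intro d" by (cases d) (auto simp: derives_def)
  with d have "derives L \<Gamma> A (BotEC 0 A d)"
    using assms(2,3) by (auto simp: derives_def intro: deduction.BotEC)
  then show ?thesis unfolding ne_def by (intro exI[of _ "BotEC 0 A d"]) simp
qed

lemma nf_AllI:
  assumes "nf L (insert (Exi (Par a)) \<Gamma>) (subst x (Par a) A)" "formula L (Forall x A)"
    and "a \<notin> params A" "\<And>B. B \<in> \<Gamma> \<Longrightarrow> a \<notin> params B"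
  shows "nf L \<Gamma> (Forall x A)"
proof -
  obtain d where d: "derives L (insert (Exi (Par a)) \<Gamma>) (subst x (Par a) A) d"
    using assms(1) by (auto simp: nf_def)
  then have *: "open_classes d - {(0, Exi (Par a))} \<subseteq> {0} \<times> \<Gamma>"
    by (auto simp: derives_def)
  have "deduction L (AllI 0 a x A d)"
    using d assms * by (intro deduction.AllI) (auto simp: derives_def)
  then have "derives L \<Gamma> (Forall x A) (AllI 0 a x A d)"
    using d * by (simp add: derives_def)
  then show ?thesis by (auto simp: nf_def)
qed

lemma ne_AllE:
  assumes "ne L \<Gamma> (Forall x A)" "nf L \<Gamma> (Exi t)"
  shows "ne L \<Gamma> (subst x t A)"
proof -
  obtain d e where "derives L \<Gamma> (Forall x A) d" "\<not> is_intro d" "derives L \<Gamma> (Exi t) e"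
    using assms by (auto simp: nf_def ne_def)
  then have "derives L \<Gamma> (subst x t A) (AllE (subst x t A) d e)"
    by (auto simp: derives_def intro: deduction.AllE)
  then show ?thesis unfolding ne_def by (intro exI[of _ "AllE (subst x t A) d e"]) simp
qed

text \<open>If the deduction of \<open>Exi t\<close> ends with \<open>AD\<close> from
  \<open>Eq t t\<close>, applying \<open>EqI\<close> would make a maximal existence formula; the
  premise of that \<open>AD\<close> is already the required deduction.\<close>

lemma nf_EqI:
  assumes "nf L \<Gamma> (Exi t)"
  shows "nf L \<Gamma> (Eq t t)"
proof -
  obtain d where d: "derives L \<Gamma> (Exi t) d" using assms by (auto simp: nf_def)
  show ?thesis
  proof (cases "\<exists>e. d = AD t e \<and> concl e = Eq t t")
    case True
    then obtain e where e: "d = AD t e" "concl e = Eq t t" by blast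
    have "deduction L e"
      using d e(1) by (auto simp: derives_def elim: deduction.cases)
    with d e have "derives L \<Gamma> (Eq t t) e" by (simp add: derives_def)
    then show ?thesis by (auto simp: nf_def)
  next
    case False
    with d have "derives L \<Gamma> (Eq t t) (EqI t d)"
      by (auto simp: derives_def intro: deduction.EqI)
    then show ?thesis by (auto simp: nf_def)
  qed
qed

section \<open>Admissibility of \<open>AD\<close> and \<open>EqE\<close>\<close>

fun args :: "('c, 'r) fm \<Rightarrow> 'c tm set" where
  "args (Pred R ts) = set ts"
| "args (Eq s t) = {s, t}"
| "args _ = {}"

lemma deduction_AD: "deduction L d \<Longrightarrow> t \<in> args (concl d) \<Longrightarrow> deduction L (AD t d)"
  by (cases "concl d") (auto intro: deduction.AD_Pred deduction.AD_Eq)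

text \<open>Substitution acts position by position: where the instance with \<open>t2\<close> does
  not have \<open>t2\<close> itself, it agrees with the instance with \<open>t1\<close>.\<close>

lemma args_subst:
  assumes "t \<in> args (subst x t2 A)" "prime_fm A"
  shows "t = t2 \<or> t \<in> args (subst x t1 A)"
proof -
  have tm: "subst_tm x t2 r = t2 \<or> subst_tm x t2 r = subst_tm x t1 r" for r
    by (cases r) auto
  show ?thesis
  proof (cases A)
    case (Pred R ts)
    then obtain r where "r \<in> set ts" "t = subst_tm x t2 r" using assms by auto
    then show ?thesis using tm[of r] Pred by auto
  next
    case (Eq r s)
    then show ?thesis using assms tm[of r] tm[of s] by auto
  qed (use assms in auto)
qed

text \<open>
  An application of \<open>AD\<close> to the conclusion of \<open>EqE\<close> is moved to whichever premise of \<open>EqE\<close>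
  contains the term.
\<close>

lemma normal_AD:
  assumes "deduction L d" "normal d" "t \<in> args (concl d)"
  shows "\<exists>d'. deduction L d' \<and> concl d' = Exi t \<and> normal d' \<and> open_classes d' \<subseteq> open_classes d"
  using assms
proof (induction arbitrary: t rule: deduction.induct)
  case (EqI d s)
  \<comment> \<open>Here \<open>t\<close> is \<open>s\<close>, and the premise of \<open>EqI\<close>
    already proves \<open>Exi s\<close>; this removes a maximal \<open>=\<close>-formula.\<close>
  then show ?case by auto
next
  case (EqE d e t1 t2 x A)
  then consider "t = t2" | "t \<in> args (concl e)"
    using args_subst[of t x t2 A t1] by auto
  then show ?case
    using EqE by cases fastforce+
next
  case (Assm A u)
  then show ?case
    by (intro exI[of _ "AD t (Assm u A)"]) (auto intro: deduction_AD deduction.Assm)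
next
  case (ImpE d e A B)
  then show ?case
    by (intro exI[of _ "AD t (ImpE B d e)"]) (auto intro: deduction_AD deduction.ImpE)
next
  case (BotEC d A u)
  then show ?case
    by (intro exI[of _ "AD t (BotEC u A d)"]) (auto intro: deduction_AD deduction.BotEC)
next
  case (AllE d e x A s)
  then show ?case
    by (intro exI[of _ "AD t (AllE (subst x s A) d e)"]) (auto intro: deduction_AD deduction.AllE)
qed auto

lemma nf_AD:
  assumes "nf L \<Gamma> A" "t \<in> args A"
  shows "nf L \<Gamma> (Exi t)"
  using assms normal_AD[of L _ t] unfolding nf_def derives_def by blast

text \<open>The terms may coincide, as happens when a substitution for parameters identifies them;
  then the minor premise is already the conclusion. Existence formulas are treated without
  \<open>EqE\<close>, since \<open>normal\<close> forbids it to conclude them.\<close>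

lemma nf_EqE:
  assumes eq: "nf L \<Gamma> (Eq t1 t2)" and min: "nf L \<Gamma> (subst x t1 A)" and prime: "prime_fm A"
  shows "nf L \<Gamma> (subst x t2 A)"
proof -
  consider "t1 = t2" | s where "A = Exi s" | "t1 \<noteq> t2" "\<forall>t. subst x t2 A \<noteq> Exi t"
    using prime by (cases A) auto
  then show ?thesis
  proof cases
    case 1
    with min show ?thesis by simp
  next
    case 2
    \<comment> \<open>If the replacement really changes the formula, the result is
      \<open>Exi t2\<close>, which \<open>AD\<close> yields from the major premise alone.\<close>
    have "nf L \<Gamma> (Exi t2)" using nf_AD[OF eq] by simp
    moreover have "subst_tm x t2 s = t2 \<or> subst_tm x t2 s = subst_tm x t1 s" by (cases s) auto
    ultimately show ?thesis using min 2 by auto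
  next
    case 3
    obtain d e where d: "derives L \<Gamma> (Eq t1 t2) d" and e: "derives L \<Gamma> (subst x t1 A) e"
      using eq min by (auto simp: nf_def)
    \<comment> \<open>The only introduction rule for identity concludes \<open>t = t\<close>, but
      the two terms differ here.\<close>
    have "\<not> is_intro d" using d 3(1) by (cases d) (auto simp: derives_def)
    with d e 3 prime have "derives L \<Gamma> (subst x t2 A) (EqE (subst x t2 A) d e)"
      by (auto simp: derives_def intro: deduction.EqE)
    then show ?thesis by (auto simp: nf_def)
  qed
qed

section \<open>The Kripke model\<close>

text \<open>Finiteness guarantees a parameter fresh for the world, and well-formedness lets each
  member be used as an assumption.\<close>

definition world :: "('c, 'r) language \<Rightarrow> ('c, 'r) fm set \<Rightarrow> bool" where
  "world L \<Gamma> \<longleftrightarrow> finite \<Gamma> \<and> (\<forall>A\<in>\<Gamma>. formula L A)"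

lemma world_insert [simp]: "world L (insert A \<Gamma>) \<longleftrightarrow> formula L A \<and> world L \<Gamma>"
  by (auto simp: world_def)

text \<open>Invariant under substitution, so that instances of \<open>A\<close> lie below
  \<open>Forall x A\<close>, although they are not subformulas in the structural sense.\<close>

fun degree :: "('c, 'r) fm \<Rightarrow> nat" where
  "degree (Imp A B) = Suc (degree A + degree B)"
| "degree (Forall x A) = Suc (degree A)"
| "degree _ = 0"

lemma degree_subst [simp]: "degree (subst x t A) = degree A"
  by (induction A) auto

function forces :: "('c, 'r) language \<Rightarrow> ('c, 'r) fm set \<Rightarrow> ('c, 'r) fm \<Rightarrow> bool" where
  "forces L \<Gamma> (Imp A B) \<longleftrightarrow>
     (\<forall>\<Delta>. \<Gamma> \<subseteq> \<Delta> \<longrightarrow> world L \<Delta> \<longrightarrow> forces L \<Delta> A \<longrightarrow> forces L \<Delta> B)"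
| "forces L \<Gamma> (Forall x A) \<longleftrightarrow>
     (\<forall>\<Delta> t. \<Gamma> \<subseteq> \<Delta> \<longrightarrow> world L \<Delta> \<longrightarrow> nf L \<Delta> (Exi t) \<longrightarrow> forces L \<Delta> (subst x t A))"
| "forces L \<Gamma> (Pred R ts) \<longleftrightarrow> nf L \<Gamma> (Pred R ts)"
| "forces L \<Gamma> (Exi t) \<longleftrightarrow> nf L \<Gamma> (Exi t)"
| "forces L \<Gamma> (Eq s t) \<longleftrightarrow> nf L \<Gamma> (Eq s t)"
| "forces L \<Gamma> Bot \<longleftrightarrow> nf L \<Gamma> Bot"
  by pat_completeness auto
termination
  by (relation "measure (\<lambda>(L, \<Gamma>, A). degree A)") auto

lemma forces_prime: "prime_fm A \<Longrightarrow> forces L \<Gamma> A \<longleftrightarrow> nf L \<Gamma> A"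
  by (cases A) auto

lemma forces_mono: "forces L \<Gamma> A \<Longrightarrow> \<Gamma> \<subseteq> \<Delta> \<Longrightarrow> forces L \<Delta> A"
  by (cases A) (auto intro: nf_mono)

text \<open>The two directions need each other: reflecting an implication reifies its antecedent,
  and reifying an implication reflects the antecedent as a new assumption.\<close>

lemma reflect_reify:
  assumes "world L \<Gamma>" "formula L A"
  shows "(ne L \<Gamma> A \<longrightarrow> forces L \<Gamma> A) \<and> (forces L \<Gamma> A \<longrightarrow> nf L \<Gamma> A)"
  using assms
proof (induction "degree A" arbitrary: A \<Gamma> rule: less_induct)
  case less
  show ?case
  proof (cases A)
    case (Imp B C)
    have fm: "formula L B" "formula L C"
      using less.prems Imp by (auto simp: formula_def)
    have "forces L \<Gamma> A" if ne: "ne L \<Gamma> A"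
      unfolding Imp forces.simps
    proof (intro allI impI)
      fix \<Delta> assume \<Delta>: "\<Gamma> \<subseteq> \<Delta>" "world L \<Delta>" "forces L \<Delta> B"
      then have "nf L \<Delta> B" using less.hyps[of B \<Delta>] fm Imp by simp
      then have "ne L \<Delta> C" using ne_mono[OF ne \<Delta>(1)] Imp ne_ImpE by blast
      then show "forces L \<Delta> C" using less.hyps[of C \<Delta>] fm Imp \<Delta> by simp
    qed
    moreover have "nf L \<Gamma> A" if forced: "forces L \<Gamma> A"
    proof -
      have world: "world L (insert B \<Gamma>)" using less.prems fm by simp
      \<comment> \<open>The added assumption \<open>B\<close> is neutral and hence forced, so the
        forced implication can be applied to it.\<close>
      have "forces L (insert B \<Gamma>) B"
        using less.hyps[of B "insert B \<Gamma>"] world fm Imp ne_Assm[of L B "insert B \<Gamma>"] by simp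
      then have "forces L (insert B \<Gamma>) C" using forced world Imp by auto
      then have "nf L (insert B \<Gamma>) C"
        using less.hyps[of C "insert B \<Gamma>"] world fm Imp by simp
      then show ?thesis using nf_ImpI fm Imp by blast
    qed
    ultimately show ?thesis by blast
  next
    case (Forall x B)
    have fm: "formula L (Forall x B)" using less.prems Forall by simp
    have "forces L \<Gamma> A" if ne: "ne L \<Gamma> A"
      unfolding Forall forces.simps
    proof (intro allI impI)
      fix \<Delta> t assume \<Delta>: "\<Gamma> \<subseteq> \<Delta>" "world L \<Delta>" "nf L \<Delta> (Exi t)"
      then have "ne L \<Delta> (subst x t B)" using ne_mono[OF ne \<Delta>(1)] Forall ne_AllE by blast
      then show "forces L \<Delta> (subst x t B)"
        using less.hyps[of "subst x t B" \<Delta>] Forall \<Delta> formula_subst[OF fm nf_formula] by simp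
    qed
    moreover have "nf L \<Gamma> A" if forced: "forces L \<Gamma> A"
    proof -
      \<comment> \<open>A fresh parameter \<open>a\<close>, assumed to exist, serves as generic
        element; freshness gives the eigenparameter condition of \<open>nf_AllI\<close>.\<close>
      have "finite (params B \<union> (\<Union>C\<in>\<Gamma>. params C))"
        using less.prems finite_params by (auto simp: world_def)
      then obtain a where a: "a \<notin> params B \<union> (\<Union>C\<in>\<Gamma>. params C)"
        using ex_new_if_finite[OF infinite_UNIV_nat] by blast
      let ?\<Delta> = "insert (Exi (Par a)) \<Gamma>"
      have Exi: "formula L (Exi (Par a))" by (simp add: formula_def)
      then have world: "world L ?\<Delta>" using less.prems by simp
      have "nf L ?\<Delta> (Exi (Par a))" using Exi by (intro ne_imp_nf ne_Assm) auto
      then have "forces L ?\<Delta> (subst x (Par a) B)" using forced world Forall by auto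
      then have "nf L ?\<Delta> (subst x (Par a) B)"
        using less.hyps[of "subst x (Par a) B" ?\<Delta>] world Forall formula_subst[OF fm Exi] by simp
      then show ?thesis using nf_AllI[OF _ fm] a Forall by blast
    qed
    ultimately show ?thesis by blast
  qed (auto intro: ne_imp_nf)
qed

lemma forces_Assm: "world L \<Gamma> \<Longrightarrow> A \<in> \<Gamma> \<Longrightarrow> forces L \<Gamma> A"
  using reflect_reify ne_Assm unfolding world_def by blast

text \<open>Introductions for \<open>Imp\<close> and \<open>Forall\<close> follow the clauses of
  \<open>forces\<close>, monotonicity carrying the open assumptions to later worlds; their
  eliminations instantiate these clauses at \<open>\<Gamma>\<close> itself. The remaining rules are
  the admissible rules for \<open>nf\<close> and \<open>ne\<close>.\<close>

lemma soundness:
  assumes "deduction L d" "world L \<Gamma>" "\<And>a. formula L (Exi (\<sigma> a) :: ('c, 'r) fm)"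
    and "\<And>u B. (u, B) \<in> open_classes d \<Longrightarrow> forces L \<Gamma> (psubst \<sigma> B)"
  shows "forces L \<Gamma> (psubst \<sigma> (concl d :: ('c, 'r) fm))"
  using assms
proof (induction arbitrary: \<Gamma> \<sigma> rule: deduction.induct)
  case (Assm A u)
  then show ?case by simp
next
  case (ImpI d A u)
  show ?case
    unfolding concl.simps psubst.simps forces.simps
  proof (intro allI impI)
    fix \<Delta> assume \<Delta>: "\<Gamma> \<subseteq> \<Delta>" "world L \<Delta>" "forces L \<Delta> (psubst \<sigma> A)"
    show "forces L \<Delta> (psubst \<sigma> (concl d))"
    proof (rule ImpI.IH[OF \<Delta>(2) ImpI.prems(2)])
      fix v B assume "(v, B) \<in> open_classes d"
      then show "forces L \<Delta> (psubst \<sigma> B)"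
        using \<Delta> ImpI.prems(3)[of v B] forces_mono by (cases "(v, B) = (u, A)") auto
    qed
  qed
next
  case (ImpE d e A B)
  have "forces L \<Gamma> (psubst \<sigma> (concl d))" "forces L \<Gamma> (psubst \<sigma> (concl e))"
    using ImpE.prems by (auto intro: ImpE.IH)
  then show ?case using ImpE.hyps ImpE.prems(1) by auto
next
  case (BotEC d A u)
  \<comment> \<open>The discharged negation is forced once it is added to the world;
    \<open>ne_BotEC\<close> discharges it again.\<close>
  let ?\<Delta> = "insert (Neg (psubst \<sigma> A)) \<Gamma>"
  have fm: "formula L (psubst \<sigma> A)"
    using formula_psubst[of L \<sigma> A] BotEC by blast
  have world: "world L ?\<Delta>" using BotEC.prems(1) fm by (simp add: formula_def)
  have "forces L ?\<Delta> (psubst \<sigma> (concl d))"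
  proof (rule BotEC.IH[OF world BotEC.prems(2)])
    fix v B assume "(v, B) \<in> open_classes d"
    then show "forces L ?\<Delta> (psubst \<sigma> B)"
      using forces_Assm[OF world, of "Neg (psubst \<sigma> A)"] BotEC.prems(3)[of v B]
        forces_mono[of L \<Gamma> "psubst \<sigma> B" ?\<Delta>]
      by (cases "(v, B) = (u, Neg A)") (auto simp del: forces.simps)
  qed
  then have "ne L \<Gamma> (psubst \<sigma> A)" using BotEC.hyps fm by (intro ne_BotEC) auto
  then show ?case using BotEC.hyps by (simp add: forces_prime ne_imp_nf)
next
  case (AllI d x a A u)
  show ?case
    unfolding concl.simps psubst.simps forces.simps
  proof (intro allI impI)
    fix \<Delta> t assume \<Delta>: "\<Gamma> \<subseteq> \<Delta>" "world L \<Delta>" "nf L \<Delta> (Exi t)"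
    \<comment> \<open>Sending the eigenparameter to \<open>t\<close> turns the premise into the
      required instance. The discharged class becomes \<open>Exi t\<close>, and the other open
      assumptions do not contain \<open>a\<close>.\<close>
    let ?\<tau> = "\<sigma>(a := t)"
    have \<tau>: "formula L (Exi (?\<tau> b) :: ('c, 'r) fm)" for b
      using AllI.prems(2) nf_formula[OF \<Delta>(3)] by simp
    have fresh: "a \<notin> params B \<Longrightarrow> psubst ?\<tau> B = psubst \<sigma> B" for B :: "('c, 'r) fm"
      by (rule psubst_cong) auto
    have "forces L \<Delta> (psubst ?\<tau> (concl d))"
    proof (rule AllI.IH[OF \<Delta>(2) \<tau>])
      fix v B assume B: "(v, B) \<in> open_classes d"
      show "forces L \<Delta> (psubst ?\<tau> B)"
      proof (cases "(v, B) = (u, Exi (Par a))")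
        case True
        then show ?thesis using \<Delta> by simp
      next
        case False
        with B have "a \<notin> params B" using AllI.hyps by fast
        moreover have "forces L \<Gamma> (psubst \<sigma> B)" using B False AllI.prems(3) by auto
        ultimately show ?thesis using \<Delta>(1) forces_mono fresh by metis
      qed
    qed
    moreover have "psubst ?\<tau> (concl d) = subst x t (psubst \<sigma> A)"
      using AllI.hyps \<tau> fresh[of A] by (simp add: psubst_subst formula_def)
    ultimately show "forces L \<Delta> (subst x t (psubst \<sigma> A))" by simp
  qed
next
  case (AllE d e x A t)
  have "forces L \<Gamma> (psubst \<sigma> (concl d))" "forces L \<Gamma> (psubst \<sigma> (concl e))"
    using AllE.prems by (auto intro: AllE.IH)
  then show ?case
    using AllE.hyps AllE.prems by (auto simp: psubst_subst formula_def)
next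
  case (EqI d t)
  then show ?case by (auto intro!: nf_EqI)
next
  case (EqE d e t1 t2 x A)
  have "forces L \<Gamma> (psubst \<sigma> (concl d))" "forces L \<Gamma> (psubst \<sigma> (concl e))"
    using EqE.prems by (auto intro: EqE.IH)
  moreover have subst: "psubst \<sigma> (subst x t A) = subst x (psubst_tm \<sigma> t) (psubst \<sigma> A)" for t
    using EqE.prems(2) by (simp add: psubst_subst formula_def)
  moreover have "prime_fm (subst x t (psubst \<sigma> A))" for t
    using EqE.hyps by (cases A) auto
  ultimately show ?case
    using EqE.hyps nf_EqE[of L \<Gamma> "psubst_tm \<sigma> t1" "psubst_tm \<sigma> t2" x "psubst \<sigma> A"]
    by (simp add: forces_prime)
next
  case (AD_Pred d R ts t)
  have "forces L \<Gamma> (psubst \<sigma> (concl d))" using AD_Pred.prems by (auto intro: AD_Pred.IH)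
  then show ?case using AD_Pred.hyps by (auto intro: nf_AD)
next
  case (AD_Eq d t1 t2 t)
  have "forces L \<Gamma> (psubst \<sigma> (concl d))" using AD_Eq.prems by (auto intro: AD_Eq.IH)
  then show ?case using AD_Eq.hyps by (auto intro: nf_AD)
qed

theorem theorem5:
  fixes L :: "('c, 'r) language"
    and d :: "('c, 'r) ded"
    and A :: "('c, 'r) fm"
    and \<Gamma> :: "('c, 'r) fm set"
  assumes "deduction L d"
    and "concl d = A"
    and "open_assms d \<subseteq> \<Gamma>"
  shows "\<exists>d'. deduction L d' \<and> concl d' = A \<and> open_assms d' \<subseteq> \<Gamma> \<and> normal_form d'"
proof -
  \<comment> \<open>\<open>\<Gamma>\<close> may be infinite or contain ill-formed members; the open
    assumptions of \<open>d\<close> always form a world.\<close>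
  let ?\<Delta> = "open_assms d"
  have world: "world L ?\<Delta>"
    using finite_open_classes formula_open_classes[OF assms(1)]
    by (auto simp: world_def open_assms_def)
  \<comment> \<open>Evaluation under the identity substitution, in the world where every open
    assumption is forced by reflection.\<close>
  have "forces L ?\<Delta> (psubst Par (concl d))"
  proof (rule soundness[OF assms(1) world])
    fix u B assume "(u, B) \<in> open_classes d"
    then have "B \<in> ?\<Delta>" by (force simp: open_assms_def)
    then show "forces L ?\<Delta> (psubst Par B)" using forces_Assm[OF world] by (simp add: psubst_Par)
  qed (simp add: formula_def)
  then have "nf L ?\<Delta> A"
    using reflect_reify[OF world] formula_concl[OF assms(1)] assms(2) by (simp add: psubst_Par)
  then obtain d' where "derives L ?\<Delta> A d'" by (auto simp: nf_def)
  then have "deduction L d'" "concl d' = A" "normal d'" "open_assms d' \<subseteq> ?\<Delta>"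
    by (auto simp: derives_def open_assms_def)
  then show ?thesis using assms(3) normal_imp_normal_form by blast
qed

end
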